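(* Every Wajsberg algebra is an implicative-orthomodular algebra, a pre-Wajsberg algebra and a meta-Wajsberg algebra.
   Context: A Wajsberg algebra is an algebra $(X,\to,^*,1)$ of type $(2,1,0)$ such that for all $x,y,z\in X$: $1\to x=x$; $(y\to z)\to ((z\to x)\to (y\to x))=1$; $(x\to y)\to y=(y\to x)\to x$; $(x^*\to y^* )\to (y\to x)=1$. It is known that, with $0:=1^*$, a Wajsberg algebra is an involutive BE algebra with $x^*=x\to 0$. A BE algebra is an algebra $(X,\to,1)$ of type $(2,0)$ such that for all $x,y,z\in X$: $x\to x=1$; $x\to 1=1$; $1\to x=x$; $x\to (y\to z)=y\to (x\to z)$. Write $x\le y$ iff $x\to y=1$. It is bounded if there is $0\in X$ with $0\le x$ for all $x\in X$; then $x^*:=x\to 0$. It is involutive if it is bounded and $x^{**}=x$ for all $x\in X$; an involutive BE algebra is denoted $(X,\to,^*,1)$. In an involutive BE algebra define $x\Cap y=((x^*\to y^* )\to y^* )^*$. An involutive BE algebra $X$ is called: - implicative-orthomodular if $x\to (y\Cap (z\Cap x))=(x\to y)\Cap (x\to z)$ for all $x,y,z\in X$; - pre-Wajsberg if $x\to (x\Cap y)=x\to y$ for all $x,y\in X$; - meta-Wajsberg if $(x\Cap y)\to (y\Cap x)=1$ for all $x,y\in X$. *)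

theory Defs
  imports Main
begin

locale wajsberg_algebra =
  fixes X :: "'a set"
    and imp :: "'a \<Rightarrow> 'a \<Rightarrow> 'a" (infixr "\<rightarrow>" 60)
    and star :: "'a \<Rightarrow> 'a" ("_\<^sup>\<star>" [1000] 999)
    and one :: "'a" ("\<one>")
  assumes imp_closed: "\<lbrakk>x \<in> X; y \<in> X\<rbrakk> \<Longrightarrow> x \<rightarrow> y \<in> X"
    and star_closed: "x \<in> X \<Longrightarrow> x\<^sup>\<star> \<in> X"
    and one_closed: "\<one> \<in> X"
    and W1: "x \<in> X \<Longrightarrow> \<one> \<rightarrow> x = x"
    and W2: "\<lbrakk>x \<in> X; y \<in> X; z \<in> X\<rbrakk> \<Longrightarrow> (y \<rightarrow> z) \<rightarrow> ((z \<rightarrow> x) \<rightarrow> (y \<rightarrow> x)) = \<one>"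
    and W3: "\<lbrakk>x \<in> X; y \<in> X\<rbrakk> \<Longrightarrow> (x \<rightarrow> y) \<rightarrow> y = (y \<rightarrow> x) \<rightarrow> x"
    and W4: "\<lbrakk>x \<in> X; y \<in> X\<rbrakk> \<Longrightarrow> (x\<^sup>\<star> \<rightarrow> y\<^sup>\<star>) \<rightarrow> (y \<rightarrow> x) = \<one>"

locale BE_algebra =
  fixes X :: "'a set"
    and imp :: "'a \<Rightarrow> 'a \<Rightarrow> 'a" (infixr "\<rightarrow>" 60)
    and one :: "'a" ("\<one>")
  assumes imp_closed: "\<lbrakk>x \<in> X; y \<in> X\<rbrakk> \<Longrightarrow> x \<rightarrow> y \<in> X"
    and one_closed: "\<one> \<in> X"
    and BE1: "x \<in> X \<Longrightarrow> x \<rightarrow> x = \<one>"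
    and BE2: "x \<in> X \<Longrightarrow> x \<rightarrow> \<one> = \<one>"
    and BE3: "x \<in> X \<Longrightarrow> \<one> \<rightarrow> x = x"
    and BE4: "\<lbrakk>x \<in> X; y \<in> X; z \<in> X\<rbrakk> \<Longrightarrow> x \<rightarrow> (y \<rightarrow> z) = y \<rightarrow> (x \<rightarrow> z)"
begin

definition le :: "'a \<Rightarrow> 'a \<Rightarrow> bool" (infix "\<preceq>" 50)
  where "x \<preceq> y \<longleftrightarrow> x \<rightarrow> y = \<one>"

end

text \<open>The least element is not part of the signature. The involution determines it:
  if \<open>z\<close> is the element below, then the star of \<open>\<one>\<close> is \<open>\<one> \<rightarrow> z = z\<close>.\<close>

locale involutive_BE_algebra =
  BE_algebra X imp one
  for X :: "'a set"
    and imp :: "'a \<Rightarrow> 'a \<Rightarrow> 'a" (infixr "\<rightarrow>" 60)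
    and star :: "'a \<Rightarrow> 'a" ("_\<^sup>\<star>" [1000] 999)
    and one :: "'a" ("\<one>") +
  assumes bounded: "\<exists>z\<in>X. (\<forall>x\<in>X. z \<preceq> x) \<and> (\<forall>x\<in>X. x\<^sup>\<star> = x \<rightarrow> z)"
    and involutive: "x \<in> X \<Longrightarrow> (x\<^sup>\<star>)\<^sup>\<star> = x"
begin

definition Cap :: "'a \<Rightarrow> 'a \<Rightarrow> 'a" (infixl "\<Cap>" 70)
  where "x \<Cap> y = ((x\<^sup>\<star> \<rightarrow> y\<^sup>\<star>) \<rightarrow> y\<^sup>\<star>)\<^sup>\<star>"

end

locale implicative_orthomodular_algebra = involutive_BE_algebra +
  assumes implicative_orthomodular:
    "\<lbrakk>x \<in> X; y \<in> X; z \<in> X\<rbrakk> \<Longrightarrow> x \<rightarrow> (y \<Cap> (z \<Cap> x)) = (x \<rightarrow> y) \<Cap> (x \<rightarrow> z)"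

locale pre_wajsberg_algebra = involutive_BE_algebra +
  assumes pre_wajsberg: "\<lbrakk>x \<in> X; y \<in> X\<rbrakk> \<Longrightarrow> x \<rightarrow> (x \<Cap> y) = x \<rightarrow> y"

locale meta_wajsberg_algebra = involutive_BE_algebra +
  assumes meta_wajsberg: "\<lbrakk>x \<in> X; y \<in> X\<rbrakk> \<Longrightarrow> (x \<Cap> y) \<rightarrow> (y \<Cap> x) = \<one>"

end

theory Submission
  imports Defs
begin

text \<open>In the order \<open>x \<preceq> y \<longleftrightarrow> x \<rightarrow> y = \<one>\<close> the element \<open>x \<Cap> y\<close> is the meet of \<open>x\<close> and \<open>y\<close>.
  By residuation \<open>x \<rightarrow> (w \<rightarrow> y) = (x \<rightarrow> w\<^sup>\<star>)\<^sup>\<star> \<rightarrow> y\<close> the map \<open>x \<rightarrow> _\<close> preserves meets, and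
  \<open>x \<rightarrow> (z \<Cap> x) = x \<rightarrow> z\<close> because \<open>((u \<rightarrow> v) \<rightarrow> v) \<rightarrow> v = u \<rightarrow> v\<close>. These two facts
  give the implicative-orthomodular law.\<close>

context wajsberg_algebra
begin

lemma imp_self: "x \<rightarrow> x = \<one>" if "x \<in> X"
  using W2[of x \<one> \<one>] that by (simp add: W1 one_closed imp_closed)

lemma imp_antisym: "x = y" if "x \<rightarrow> y = \<one>" "y \<rightarrow> x = \<one>" "x \<in> X" "y \<in> X"
  using W3[of x y] that by (simp add: W1)

lemma le_imp_imp: "x \<rightarrow> ((x \<rightarrow> y) \<rightarrow> y) = \<one>" if "x \<in> X" "y \<in> X"
  using W2[of y \<one> x] that by (simp add: W1 one_closed)

text \<open>\<open>W3\<close> rewrites \<open>(x \<rightarrow> \<one>) \<rightarrow> \<one>\<close>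
  to \<open>x \<rightarrow> x\<close>, which is \<open>\<one>\<close>, so \<open>le_imp_imp\<close>
  at \<open>y = \<one>\<close> becomes the claim.\<close>

lemma imp_one: "x \<rightarrow> \<one> = \<one>" if "x \<in> X"
  using le_imp_imp[of x \<one>] W3[of x \<one>] that by (simp add: W1 one_closed imp_self)

lemma imp_trans: "x \<rightarrow> z = \<one>" if "x \<rightarrow> y = \<one>" "y \<rightarrow> z = \<one>" "x \<in> X" "y \<in> X" "z \<in> X"
  using W2[of z x y] that by (simp add: W1 one_closed imp_closed)

lemma imp_antimono: "(y \<rightarrow> z) \<rightarrow> (x \<rightarrow> z) = \<one>" if "x \<rightarrow> y = \<one>" "x \<in> X" "y \<in> X" "z \<in> X"
  using W2[of z x y] that by (simp add: W1 imp_closed)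

lemma le_imp: "x \<rightarrow> (y \<rightarrow> x) = \<one>" if "x \<in> X" "y \<in> X"
  using imp_antimono[of y \<one> x] that by (simp add: W1 one_closed imp_one)

text \<open>Since \<open>y\<close> lies below \<open>(y \<rightarrow> z) \<rightarrow> z\<close>, an
  instance of \<open>W2\<close> with that element in place of \<open>y\<close> can be weakened by
  antitonicity.\<close>

lemma imp_exchange_le: "(x \<rightarrow> (y \<rightarrow> z)) \<rightarrow> (y \<rightarrow> (x \<rightarrow> z)) = \<one>" if "x \<in> X" "y \<in> X" "z \<in> X"
proof (rule imp_trans)
  show "(x \<rightarrow> (y \<rightarrow> z)) \<rightarrow> (((y \<rightarrow> z) \<rightarrow> z) \<rightarrow> (x \<rightarrow> z)) = \<one>"
    using that by (simp add: W2 imp_closed)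
  show "(((y \<rightarrow> z) \<rightarrow> z) \<rightarrow> (x \<rightarrow> z)) \<rightarrow> (y \<rightarrow> (x \<rightarrow> z)) = \<one>"
    using that by (intro imp_antimono le_imp_imp imp_closed)
qed (use that in \<open>simp_all add: imp_closed\<close>)

lemma imp_exchange: "x \<rightarrow> (y \<rightarrow> z) = y \<rightarrow> (x \<rightarrow> z)" if "x \<in> X" "y \<in> X" "z \<in> X"
  by (rule imp_antisym) (use that in \<open>simp_all add: imp_exchange_le imp_closed\<close>)

lemma imp_mono: "(z \<rightarrow> x) \<rightarrow> (z \<rightarrow> y) = \<one>" if "x \<rightarrow> y = \<one>" "x \<in> X" "y \<in> X" "z \<in> X"
  using W2[of y z x] imp_exchange[of "z \<rightarrow> x" "x \<rightarrow> y" "z \<rightarrow> y"] that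
  by (simp add: W1 imp_closed)

lemma imp_imp_imp: "((x \<rightarrow> y) \<rightarrow> y) \<rightarrow> y = x \<rightarrow> y" if "x \<in> X" "y \<in> X"
  by (rule imp_antisym) (use that in \<open>simp_all add: imp_antimono le_imp_imp imp_closed\<close>)

text \<open>\<open>W4\<close> against \<open>\<one>\<close> puts
  \<open>x\<^sup>\<star> \<rightarrow> \<one>\<^sup>\<star>\<close> below \<open>x\<close>, and
  \<open>\<one>\<^sup>\<star>\<close> lies below that implication.\<close>

lemma zero_le: "\<one>\<^sup>\<star> \<rightarrow> x = \<one>" if "x \<in> X"
  using W4[of x \<one>] imp_trans[of "\<one>\<^sup>\<star>" "x\<^sup>\<star> \<rightarrow> \<one>\<^sup>\<star>" x] le_imp[of "\<one>\<^sup>\<star>" "x\<^sup>\<star>"] that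
  by (simp add: W1 imp_closed star_closed one_closed)

lemma star_eq: "x\<^sup>\<star> = x \<rightarrow> \<one>\<^sup>\<star>" if x: "x \<in> X"
proof (rule imp_antisym)
  note cl = x imp_closed star_closed one_closed
  show "x\<^sup>\<star> \<rightarrow> (x \<rightarrow> \<one>\<^sup>\<star>) = \<one>"
    by (rule imp_trans[of _ "(\<one>\<^sup>\<star>)\<^sup>\<star> \<rightarrow> x\<^sup>\<star>"]) (simp_all add: cl le_imp W4)
  have "(x\<^sup>\<star> \<rightarrow> \<one>\<^sup>\<star>) \<rightarrow> x = \<one>"
    using W4[of x \<one>] by (simp add: cl W1)
  then have "(x \<rightarrow> \<one>\<^sup>\<star>) \<rightarrow> ((x\<^sup>\<star> \<rightarrow> \<one>\<^sup>\<star>) \<rightarrow> \<one>\<^sup>\<star>) = \<one>"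
    by (intro imp_antimono) (simp_all add: cl)
  \<comment> \<open>\<open>W3\<close> swaps the two arguments, and \<open>zero_le\<close> collapses
    the other side to \<open>\<one> \<rightarrow> x\<^sup>\<star>\<close>.\<close>
  moreover have "(x\<^sup>\<star> \<rightarrow> \<one>\<^sup>\<star>) \<rightarrow> \<one>\<^sup>\<star> = x\<^sup>\<star>"
    using W3[of "x\<^sup>\<star>" "\<one>\<^sup>\<star>"] by (simp add: cl W1 zero_le)
  ultimately show "(x \<rightarrow> \<one>\<^sup>\<star>) \<rightarrow> x\<^sup>\<star> = \<one>"
    by simp
qed (use x in \<open>simp_all add: imp_closed star_closed one_closed\<close>)

text \<open>With star as implication into zero, this is \<open>W3\<close> for \<open>x\<close> and
  zero, whose other side reduces to \<open>x\<close> by \<open>zero_le\<close>.\<close>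

lemma star_star: "(x\<^sup>\<star>)\<^sup>\<star> = x" if "x \<in> X"
  using W3[of x "\<one>\<^sup>\<star>"] that star_eq[of x] star_eq[of "x\<^sup>\<star>"]
  by (simp add: W1 imp_closed star_closed one_closed zero_le)

sublocale involutive: involutive_BE_algebra X imp star one
proof
  interpret BE_algebra X imp one
    by unfold_locales (auto simp: imp_closed one_closed imp_self imp_one W1 intro: imp_exchange)
  show "\<exists>z\<in>X. (\<forall>x\<in>X. z \<preceq> x) \<and> (\<forall>x\<in>X. x\<^sup>\<star> = x \<rightarrow> z)"
    \<comment> \<open>The witness is \<open>\<one>\<^sup>\<star>\<close>.\<close>
    using zero_le star_eq star_closed one_closed unfolding le_def by blast
qed (auto simp: imp_closed one_closed imp_self imp_one W1 star_star intro: imp_exchange)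

lemma imp_star_swap: "x \<rightarrow> y\<^sup>\<star> = y \<rightarrow> x\<^sup>\<star>" if "x \<in> X" "y \<in> X"
  using imp_exchange[of x y "\<one>\<^sup>\<star>"] that by (simp add: star_closed one_closed flip: star_eq)

lemma star_imp_star: "x\<^sup>\<star> \<rightarrow> y\<^sup>\<star> = y \<rightarrow> x" if "x \<in> X" "y \<in> X"
  using imp_star_swap[of "x\<^sup>\<star>" y] that by (simp add: star_closed star_star)

lemma Cap_closed: "x \<Cap> y \<in> X" if "x \<in> X" "y \<in> X"
  using that by (simp add: involutive.Cap_def imp_closed star_closed)

lemma Cap_commute: "x \<Cap> y = y \<Cap> x" if "x \<in> X" "y \<in> X"
  using that by (simp add: involutive.Cap_def W3 star_closed)

text \<open>Contraposition turns the claim into \<open>y\<^sup>\<star> \<rightarrow>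
  ((x\<^sup>\<star> \<rightarrow> y\<^sup>\<star>) \<rightarrow> y\<^sup>\<star>) = \<one>\<close>,
  an instance of \<open>le_imp\<close>.\<close>

lemma Cap_le2: "(x \<Cap> y) \<rightarrow> y = \<one>" if "x \<in> X" "y \<in> X"
  using star_imp_star[of y "x \<Cap> y"] that Cap_closed[of x y]
  by (simp add: involutive.Cap_def star_star imp_closed star_closed le_imp)

text \<open>\<open>(x \<rightarrow> y) \<rightarrow> y\<close> is the join: it is monotone in
  \<open>x\<close>, and with \<open>w\<close> in place of \<open>x\<close> it equals
  \<open>w\<close> by \<open>W3\<close>, because \<open>y\<close> lies below
  \<open>w\<close>.\<close>

lemma imp_imp_least: "((x \<rightarrow> y) \<rightarrow> y) \<rightarrow> w = \<one>"
  if "x \<rightarrow> w = \<one>" "y \<rightarrow> w = \<one>" "x \<in> X" "y \<in> X" "w \<in> X"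
proof -
  have "((x \<rightarrow> y) \<rightarrow> y) \<rightarrow> ((w \<rightarrow> y) \<rightarrow> y) = \<one>"
    using that by (intro imp_antimono imp_closed)
  then show ?thesis
    using W3[of w y] that by (simp add: W1)
qed

text \<open>De Morgan dual of \<open>imp_imp_least\<close>, as star reverses the order.\<close>

lemma Cap_greatest: "w \<rightarrow> (x \<Cap> y) = \<one>"
  if "w \<rightarrow> x = \<one>" "w \<rightarrow> y = \<one>" "w \<in> X" "x \<in> X" "y \<in> X"
proof -
  have "((x\<^sup>\<star> \<rightarrow> y\<^sup>\<star>) \<rightarrow> y\<^sup>\<star>) \<rightarrow> w\<^sup>\<star> = \<one>"
    using that by (intro imp_imp_least) (simp_all add: star_imp_star star_closed)
  then show ?thesis
    using that imp_star_swap[of "(x\<^sup>\<star> \<rightarrow> y\<^sup>\<star>) \<rightarrow> y\<^sup>\<star>" w]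
    by (simp add: involutive.Cap_def imp_closed star_closed)
qed

text \<open>Contraposition gives a triple implication into \<open>x\<^sup>\<star>\<close>, which
  \<open>imp_imp_imp\<close> shortens to
  \<open>y\<^sup>\<star> \<rightarrow> x\<^sup>\<star>\<close>.\<close>

lemma imp_Cap_right: "x \<rightarrow> (y \<Cap> x) = x \<rightarrow> y" if "x \<in> X" "y \<in> X"
  using that imp_star_swap[of x "(y\<^sup>\<star> \<rightarrow> x\<^sup>\<star>) \<rightarrow> x\<^sup>\<star>"]
    imp_imp_imp[of "y\<^sup>\<star>" "x\<^sup>\<star>"]
  by (simp add: involutive.Cap_def star_imp_star imp_closed star_closed)

text \<open>\<open>(x \<rightarrow> w\<^sup>\<star>)\<^sup>\<star>\<close> is the MV-algebra product of \<open>x\<close> and \<open>w\<close>.\<close>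

lemma residuation: "(x \<rightarrow> w\<^sup>\<star>)\<^sup>\<star> \<rightarrow> y = w \<rightarrow> (x \<rightarrow> y)" if "x \<in> X" "w \<in> X" "y \<in> X"
proof -
  have "(x \<rightarrow> w\<^sup>\<star>)\<^sup>\<star> \<rightarrow> y = y\<^sup>\<star> \<rightarrow> (x \<rightarrow> w\<^sup>\<star>)"
    using star_imp_star[of "x \<rightarrow> w\<^sup>\<star>" "y\<^sup>\<star>"] that by (simp add: star_star imp_closed star_closed)
  also have "\<dots> = x \<rightarrow> (w \<rightarrow> y)"
    using that by (simp add: imp_exchange[of "y\<^sup>\<star>" x] star_imp_star star_closed)
  also have "\<dots> = w \<rightarrow> (x \<rightarrow> y)"
    using that by (intro imp_exchange)
  finally show ?thesis .
qed

lemma imp_Cap_distrib: "x \<rightarrow> (y \<Cap> z) = (x \<rightarrow> y) \<Cap> (x \<rightarrow> z)"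
  if x: "x \<in> X" and y: "y \<in> X" and z: "z \<in> X"
proof (rule imp_antisym)
  note cl = x y z imp_closed star_closed Cap_closed
  have Cap_le1: "(u \<Cap> v) \<rightarrow> u = \<one>" if "u \<in> X" "v \<in> X" for u v
    using that Cap_le2[of v u] by (simp add: Cap_commute)
  show "(x \<rightarrow> (y \<Cap> z)) \<rightarrow> ((x \<rightarrow> y) \<Cap> (x \<rightarrow> z)) = \<one>"
    by (intro Cap_greatest imp_mono Cap_le1 Cap_le2) (simp_all add: cl)
  let ?w = "(x \<rightarrow> y) \<Cap> (x \<rightarrow> z)"
  \<comment> \<open>Residuation reduces the two bounds that \<open>Cap_greatest\<close> needs to
    \<open>?w\<close> lying below \<open>x \<rightarrow> y\<close> and below
    \<open>x \<rightarrow> z\<close>.\<close>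
  have "(x \<rightarrow> ?w\<^sup>\<star>)\<^sup>\<star> \<rightarrow> (y \<Cap> z) = \<one>"
    by (intro Cap_greatest) (simp_all add: cl residuation Cap_le1 Cap_le2)
  then show "?w \<rightarrow> (x \<rightarrow> (y \<Cap> z)) = \<one>"
    by (simp add: cl residuation)
qed (use that in \<open>simp_all add: imp_closed Cap_closed\<close>)

end

theorem proposition4p3:
  fixes X :: "'a set"
    and imp :: "'a \<Rightarrow> 'a \<Rightarrow> 'a"
    and star :: "'a \<Rightarrow> 'a"
    and one :: "'a"
  assumes "wajsberg_algebra X imp star one"
  shows "implicative_orthomodular_algebra X imp star one \<and>
         pre_wajsberg_algebra X imp star one \<and>
         meta_wajsberg_algebra X imp star one"
proof -
  interpret wajsberg_algebra X imp star one
    by (rule assms)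
  show ?thesis
  proof (intro conjI)
    show "implicative_orthomodular_algebra X imp star one"
      by unfold_locales (metis imp_Cap_distrib imp_Cap_right Cap_closed)
    show "pre_wajsberg_algebra X imp star one"
      by unfold_locales (metis Cap_commute imp_Cap_right)
    show "meta_wajsberg_algebra X imp star one"
      \<comment> \<open>Meets commute, so the law is an instance of reflexivity.\<close>
      by unfold_locales (metis Cap_commute Cap_closed imp_self)
  qed
qed

end
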